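(* Let $\alpha>-1$ and let $\{\gamma_{p,\alpha}\}_{p=0}^{\infty}$ be the sequence of Dunkl factorials. If $-1<\alpha\le 0$, then $\{\gamma_{p,\alpha}\}_{p=0}^{\infty}$ is a strongly regular sequence.
   Context: For $\alpha>-1$, the Dunkl factorials are defined by $\gamma_{2k,\alpha}=2^{2k}\,k!\,(\alpha+1)_k$ and $\gamma_{2k+1,\alpha}=2^{2k+1}\,k!\,(\alpha+1)_{k+1}$ for integers $k\ge 0$, where $(a)_k=a(a+1)\cdots(a+k-1)$ is the Pochhammer symbol, with $(a)_0=1$. A sequence $\{M_p\}_{p=0}^{\infty}$ of positive real numbers with $M_0=1$ is called a strongly regular sequence if it satisfies: (lc) $M_p^2\le M_{p-1}M_{p+1}$ for every $p\ge 1$; (mg) there exists $A_1>0$ such that $M_{p+q}\le A_1^{p+q}M_pM_q$ for all integers $p,q\ge 0$; (snq) there exists $A_2>0$ such that $\sum_{q\ge p}\frac{M_q}{(q+1)M_{q+1}}\le A_2\frac{M_p}{M_{p+1}}$ for every $p\ge 0$. *)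

theory Defs
  imports Complex_Main
begin

definition dunkl_factorial :: "real \<Rightarrow> nat \<Rightarrow> real" where
  "dunkl_factorial \<alpha> n =
     (let k = n div 2 in
      if even n then 2 ^ (2 * k) * fact k * pochhammer (\<alpha> + 1) k
      else 2 ^ (2 * k + 1) * fact k * pochhammer (\<alpha> + 1) (k + 1))"

lemma dunkl_factorial_even:
  "dunkl_factorial \<alpha> (2 * k) = 2 ^ (2 * k) * fact k * pochhammer (\<alpha> + 1) k"
  by (simp add: dunkl_factorial_def)

lemma dunkl_factorial_odd:
  "dunkl_factorial \<alpha> (2 * k + 1) = 2 ^ (2 * k + 1) * fact k * pochhammer (\<alpha> + 1) (k + 1)"
  by (simp add: dunkl_factorial_def)

definition log_convex_seq :: "(nat \<Rightarrow> real) \<Rightarrow> bool" where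
  "log_convex_seq M \<longleftrightarrow> (\<forall>p\<ge>1. (M p)\<^sup>2 \<le> M (p - 1) * M (p + 1))"

definition moderate_growth :: "(nat \<Rightarrow> real) \<Rightarrow> bool" where
  "moderate_growth M \<longleftrightarrow> (\<exists>A>0. \<forall>p q. M (p + q) \<le> A ^ (p + q) * M p * M q)"

text \<open>The bound on the series of nonnegative terms includes its convergence. Summability is
  required explicitly because \<^const>\<open>suminf\<close> is unspecified on divergent series. The sum over
  \<open>q \<ge> p\<close> is written with the index shifted by \<open>p\<close>.\<close>

definition strongly_non_quasianalytic :: "(nat \<Rightarrow> real) \<Rightarrow> bool" where
  "strongly_non_quasianalytic M \<longleftrightarrow>
     (let a = (\<lambda>q. M q / (real (q + 1) * M (q + 1))) in
      \<exists>A>0. \<forall>p. summable (\<lambda>j. a (p + j)) \<and> (\<Sum>j. a (p + j)) \<le> A * (M p / M (p + 1)))"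

definition strongly_regular :: "(nat \<Rightarrow> real) \<Rightarrow> bool" where
  "strongly_regular M \<longleftrightarrow>
     (\<forall>p. M p > 0) \<and> M 0 = 1 \<and>
     log_convex_seq M \<and> moderate_growth M \<and> strongly_non_quasianalytic M"

end

theory Submission
  imports Defs
begin

text \<open>
  The idea is to read every condition off the quotients \<open>m\<^sub>p = M\<^sub>p\<^sub>+\<^sub>1 / M\<^sub>p\<close>. For the Dunkl
  factorials they are almost linear: \<open>m\<^sub>2\<^sub>k = 2 (k + \<alpha> + 1)\<close> and \<open>m\<^sub>2\<^sub>k\<^sub>+\<^sub>1 = 2 (k + 1)\<close>.
  Logarithmic convexity says that the quotients never decrease. The step from \<open>2k\<close> to \<open>2k + 1\<close> needs
  \<open>\<alpha> \<le> 0\<close>, and the step from \<open>2k + 1\<close> to \<open>2k + 2\<close> needs \<open>\<alpha> \<ge> -1\<close>.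

  The other two conditions hold for every sequence whose quotients lie between two positive
  multiples of \<open>p + 1\<close>. Such a sequence agrees with \<open>p!\<close> up to geometric factors, so it
  inherits moderate growth from the bound \<open>(p + q)! \<le> 2\<^sup>p\<^sup>+\<^sup>q p! q!\<close>
  (\<open>moderate_growth_if_linear_ratio\<close>). The terms of the series in the strong
  non-quasianalyticity condition are comparable to \<open>1 / (q + 1)\<^sup>2\<close>, so its tail from \<open>p\<close> is of
  order \<open>1 / (p + 1)\<close>, which is the order of \<open>M\<^sub>p / M\<^sub>p\<^sub>+\<^sub>1\<close>
  (\<open>strongly_non_quasianalytic_if_linear_ratio\<close>).
\<close>

lemma fact_add_le: "(fact (p + q) :: real) \<le> 2 ^ (p + q) * fact p * fact q"
proof -
  have "((p + q) choose p) \<le> 2 ^ (p + q)"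
    by (rule binomial_le_pow2)
  then have "real ((p + q) choose p) \<le> 2 ^ (p + q)"
    by (metis of_nat_le_iff of_nat_numeral of_nat_power)
  moreover have "(fact (p + q) :: real) = fact p * fact q * real ((p + q) choose p)"
    by (simp add: binomial_fact)
  ultimately show ?thesis
    by (simp add: mult_ac mult_left_mono)
qed

lemma fact_growth_lower:
  fixes M :: "nat \<Rightarrow> real"
  assumes "c \<ge> 0" and "M 0 = 1"
    and "\<And>p. c * real (p + 1) * M p \<le> M (p + 1)"
  shows "c ^ p * fact p \<le> M p"
proof (induction p)
  case 0
  show ?case using assms(2) by simp
next
  case (Suc p)
  have "c ^ Suc p * fact (Suc p) = c * real (p + 1) * (c ^ p * fact p)"
    by simp
  also have "\<dots> \<le> c * real (p + 1) * M p"
    using Suc.IH assms(1) by (intro mult_left_mono) auto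
  also have "\<dots> \<le> M (Suc p)"
    using assms(3)[of p] by simp
  finally show ?case .
qed

lemma fact_growth_upper:
  fixes M :: "nat \<Rightarrow> real"
  assumes "C \<ge> 0" and "M 0 = 1"
    and "\<And>p. M (p + 1) \<le> C * real (p + 1) * M p"
  shows "M p \<le> C ^ p * fact p"
proof (induction p)
  case 0
  show ?case using assms(2) by simp
next
  case (Suc p)
  have "M (Suc p) \<le> C * real (p + 1) * M p"
    using assms(3)[of p] by simp
  also have "\<dots> \<le> C * real (p + 1) * (C ^ p * fact p)"
    using Suc.IH assms(1) by (intro mult_left_mono) auto
  also have "\<dots> = C ^ Suc p * fact (Suc p)"
    by simp
  finally show ?case .
qed

text \<open>
  Here \<open>M\<^sub>p\<close> lies between \<open>c\<^sup>p p!\<close> and \<open>C\<^sup>p p!\<close>. Passing from \<open>M\<^sub>p\<^sub>+\<^sub>q\<close> to factorials costs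
  \<open>C\<^sup>p\<^sup>+\<^sup>q\<close>, splitting \<open>(p + q)!\<close> costs \<open>2\<^sup>p\<^sup>+\<^sup>q\<close>, and returning to \<open>M\<^sub>p M\<^sub>q\<close> costs \<open>c\<close> to the power
  \<open>-(p + q)\<close>, so the constant \<open>2 C / c\<close> works.
\<close>

lemma moderate_growth_if_linear_ratio:
  fixes M :: "nat \<Rightarrow> real"
  assumes c: "c > 0" and C: "C > 0" and M0: "M 0 = 1"
    and lower: "\<And>p. c * real (p + 1) * M p \<le> M (p + 1)"
    and upper: "\<And>p. M (p + 1) \<le> C * real (p + 1) * M p"
  shows "moderate_growth M"
  unfolding moderate_growth_def
proof (intro exI conjI allI)
  show "2 * C / c > 0" using c C by simp
next
  fix p q
  have low: "c ^ n * fact n \<le> M n" for n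
    using fact_growth_lower[of c M] c M0 lower by auto
  have "M (p + q) \<le> C ^ (p + q) * fact (p + q)"
    using fact_growth_upper[of C M] C M0 upper by auto
  also have "\<dots> \<le> C ^ (p + q) * (2 ^ (p + q) * fact p * fact q)"
    using C by (intro mult_left_mono fact_add_le) auto
  also have "\<dots> = (2 * C / c) ^ (p + q) * ((c ^ p * fact p) * (c ^ q * fact q))"
    using c by (simp add: power_mult_distrib power_divide power_add field_simps)
  also have "\<dots> \<le> (2 * C / c) ^ (p + q) * (M p * M q)"
  proof -
    have "0 \<le> M p"
      using low[of p] c by (meson fact_ge_zero less_imp_le mult_nonneg_nonneg order_trans zero_le_power)
    then show ?thesis
      using c C low by (intro mult_left_mono mult_mono) auto
  qed
  finally show "M (p + q) \<le> (2 * C / c) ^ (p + q) * M p * M q"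
    by (simp add: mult.assoc)
qed

text \<open>
  The terms of the series are at most \<open>1 / (c (q + 1)\<^sup>2)\<close>, and
  \<open>1 / (q + 1)\<^sup>2 \<le> 2 / ((q + 1) (q + 2)) = 2 (1 / (q + 1) - 1 / (q + 2))\<close> turns the tail into a
  telescoping sum with value \<open>2 / (c (p + 1))\<close>. The upper bound on the quotient at \<open>p\<close> then
  gives \<open>1 / (p + 1) \<le> C M\<^sub>p / M\<^sub>p\<^sub>+\<^sub>1\<close>.
\<close>

lemma strongly_non_quasianalytic_if_linear_ratio:
  fixes M :: "nat \<Rightarrow> real"
  assumes c: "c > 0" and C: "C > 0" and pos: "\<And>p. M p > 0"
    and lower: "\<And>p. c * real (p + 1) * M p \<le> M (p + 1)"
    and upper: "\<And>p. M (p + 1) \<le> C * real (p + 1) * M p"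
  shows "strongly_non_quasianalytic M"
proof -
  define a where "a q = M q / (real (q + 1) * M (q + 1))" for q
  define t where "t q = 2 / c * (1 / real (q + 1))" for q
  have a_nonneg: "0 \<le> a q" for q
    using pos[of q] pos[of "q + 1"] by (simp add: a_def)
  have a_le: "a q \<le> t q - t (Suc q)" for q
  proof -
    have "a q \<le> M q / (real (q + 1) * (c * real (q + 1) * M q))"
      unfolding a_def using lower[of q] pos[of q] pos[of "q + 1"] c
      by (intro divide_left_mono mult_left_mono mult_pos_pos) auto
    also have "\<dots> = 1 / c * (1 / (real (q + 1) * real (q + 1)))"
      using pos[of q] c less_imp_neq[OF pos[of q]] by (simp add: divide_simps)
    also have "\<dots> \<le> 1 / c * (2 * (1 / real (q + 1) - 1 / real (q + 2)))"
    proof (intro mult_left_mono)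
      show "1 / (real (q + 1) * real (q + 1)) \<le> 2 * (1 / real (q + 1) - 1 / real (q + 2))"
        by (simp add: divide_simps)
    qed (use c in simp)
    also have "\<dots> = t q - t (Suc q)"
      by (simp add: t_def algebra_simps)
    finally show ?thesis .
  qed
  have t_tendsto: "(\<lambda>j. t (p + j)) \<longlonglongrightarrow> 0" for p
  proof -
    have "t \<longlonglongrightarrow> 2 / c * 0"
      unfolding t_def using LIMSEQ_inverse_real_of_nat
      by (intro tendsto_mult tendsto_const) (simp add: inverse_eq_divide)
    then show ?thesis
      using LIMSEQ_ignore_initial_segment[of t 0 p] by (simp add: add.commute)
  qed
  have tail: "(\<lambda>j. t (p + j) - t (Suc (p + j))) sums t p" for p
    using telescope_sums'[OF t_tendsto[of p]] by simp
  have summ: "summable (\<lambda>j. a (p + j))" for p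
    using summable_comparison_test'[OF sums_summable[OF tail[of p]], of 0 "\<lambda>j. a (p + j)"]
      a_nonneg a_le by simp
  have "(\<Sum>j. a (p + j)) \<le> 2 * C / c * (M p / M (p + 1))" for p
  proof -
    have "(\<Sum>j. a (p + j)) \<le> t p"
      using sums_le[OF _ summable_sums[OF summ[of p]] tail[of p]] a_le by blast
    also have "t p \<le> 2 / c * (C * (M p / M (p + 1)))"
      unfolding t_def
    proof (intro mult_left_mono)
      show "1 / real (p + 1) \<le> C * (M p / M (p + 1))"
        using upper[of p] pos[of "p + 1"] by (simp add: divide_simps) (simp add: algebra_simps)
    qed (use c in simp)
    finally show ?thesis by simp
  qed
  moreover have "2 * C / c > 0"
    using c C by simp
  ultimately show ?thesis
    unfolding strongly_non_quasianalytic_def Let_def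
    using summ unfolding a_def by blast
qed

lemma dunkl_factorial_Suc_even:
  "dunkl_factorial \<alpha> (2 * k + 1) = 2 * (real k + \<alpha> + 1) * dunkl_factorial \<alpha> (2 * k)"
  unfolding dunkl_factorial_even dunkl_factorial_odd by (simp add: pochhammer_Suc algebra_simps)

lemma dunkl_factorial_Suc_odd:
  "dunkl_factorial \<alpha> (2 * k + 2) = 2 * (real k + 1) * dunkl_factorial \<alpha> (2 * k + 1)"
  using dunkl_factorial_even[of \<alpha> "k + 1"] unfolding dunkl_factorial_odd
  by (simp add: algebra_simps)

definition dunkl_ratio :: "real \<Rightarrow> nat \<Rightarrow> real" where
  "dunkl_ratio \<alpha> p = (if even p then real p + 2 * \<alpha> + 2 else real p + 1)"

lemma dunkl_factorial_Suc:
  "dunkl_factorial \<alpha> (p + 1) = dunkl_ratio \<alpha> p * dunkl_factorial \<alpha> p"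
proof (cases "even p")
  case True
  then obtain k where "p = 2 * k" by (elim evenE)
  then show ?thesis
    using dunkl_factorial_Suc_even[of \<alpha> k] by (simp add: dunkl_ratio_def algebra_simps)
next
  case False
  then obtain k where "p = 2 * k + 1" by (elim oddE)
  then show ?thesis
    using dunkl_factorial_Suc_odd[of \<alpha> k] by (simp add: dunkl_ratio_def algebra_simps)
qed

lemma dunkl_factorial_0: "dunkl_factorial \<alpha> 0 = 1"
  by (simp add: dunkl_factorial_def)

lemma dunkl_factorial_pos:
  assumes "\<alpha> > -1"
  shows "dunkl_factorial \<alpha> p > 0"
proof (induction p)
  case 0
  show ?case by (simp add: dunkl_factorial_0)
next
  case (Suc p)
  have "dunkl_ratio \<alpha> p > 0"
    using assms by (simp add: dunkl_ratio_def)
  with Suc.IH show ?case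
    using dunkl_factorial_Suc[of \<alpha> p] by simp
qed

lemma log_convex_dunkl_factorial:
  assumes "\<alpha> > -1" and "\<alpha> \<le> 0"
  shows "log_convex_seq (dunkl_factorial \<alpha>)"
  unfolding log_convex_seq_def
proof (intro allI impI)
  fix p :: nat
  assume "p \<ge> 1"
  then obtain n where p: "p = n + 1"
    by (metis add.commute le_Suc_ex)
  let ?M = "dunkl_factorial \<alpha>"
  have mono: "dunkl_ratio \<alpha> n \<le> dunkl_ratio \<alpha> (n + 1)"
    using assms by (simp add: dunkl_ratio_def)
  have "(?M p)\<^sup>2 = dunkl_ratio \<alpha> n * (?M n * ?M p)"
    unfolding p power2_eq_square by (simp only: dunkl_factorial_Suc mult_ac)
  also have "\<dots> \<le> dunkl_ratio \<alpha> (n + 1) * (?M n * ?M p)"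
    using mono dunkl_factorial_pos[OF assms(1)] by (intro mult_right_mono) (simp_all add: less_imp_le)
  also have "\<dots> = ?M (p - 1) * ?M (p + 1)"
    using dunkl_factorial_Suc[of \<alpha> p] by (simp add: p mult_ac)
  finally show "(?M p)\<^sup>2 \<le> ?M (p - 1) * ?M (p + 1)" .
qed

theorem proposition3p2:
  fixes \<alpha> :: real
  assumes "\<alpha> > -1" and "\<alpha> \<le> 0"
  shows "strongly_regular (dunkl_factorial \<alpha>)"
proof -
  \<comment> \<open>The quotient at \<open>0\<close> is \<open>2 \<alpha> + 2\<close>, which tends to \<open>0\<close> as \<open>\<alpha>\<close> approaches \<open>-1\<close>, so the lower
    constant must depend on \<open>\<alpha>\<close>.\<close>
  define c where "c = min 1 (2 * \<alpha> + 2)"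
  have c: "c > 0" "c \<le> 1" "c \<le> 2 * \<alpha> + 2"
    using assms(1) by (auto simp: c_def)
  note pos = dunkl_factorial_pos[OF assms(1)]
  have lower: "c * real (p + 1) * dunkl_factorial \<alpha> p \<le> dunkl_factorial \<alpha> (p + 1)" for p
  proof -
    have "c * real p \<le> real p"
      using c by (simp add: mult_left_le_one_le)
    then have "c * real (p + 1) \<le> dunkl_ratio \<alpha> p"
      using c by (simp add: dunkl_ratio_def algebra_simps)
    then show ?thesis
      unfolding dunkl_factorial_Suc by (intro mult_right_mono less_imp_le[OF pos])
  qed
  have upper: "dunkl_factorial \<alpha> (p + 1) \<le> 2 * real (p + 1) * dunkl_factorial \<alpha> p" for p
  proof -
    have "dunkl_ratio \<alpha> p \<le> 2 * real (p + 1)"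
      using assms(2) by (simp add: dunkl_ratio_def)
    then show ?thesis
      unfolding dunkl_factorial_Suc by (intro mult_right_mono less_imp_le[OF pos])
  qed
  show ?thesis
    unfolding strongly_regular_def
    using pos dunkl_factorial_0 log_convex_dunkl_factorial[OF assms]
      moderate_growth_if_linear_ratio[of c 2, OF c(1) _ dunkl_factorial_0 lower upper]
      strongly_non_quasianalytic_if_linear_ratio[of c 2, OF c(1) _ pos lower upper]
    by simp
qed

end
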